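(* Let $p\in\omega^*=\beta\omega\setminus\omega$ be any nonprincipal ultrafilter on $\omega$, let $\mu=d_p$ be the finitely additive measure on $\mathcal P(\omega)$ given by $d_p(A)=\lim_{p}\frac{|A\cap n|}{n}$, and let $\widehat\mu$ be the Radon measure on $\beta\omega$ determined by $\widehat\mu(\overline A)=\mu(A)$ for all $A\subseteq\omega$. Then $\widehat\mu$, regarded as the functional $f\mapsto\int f\,d\widehat\mu$ on $C(\beta\omega)$, is not measurable with respect to the $\sigma$-algebra $Borel(C(\beta\omega),\tau_p)$. In particular, $$Borel(C(\beta\omega),\tau_p)\neq Borel(C(\beta\omega),weak).$$
   Context: $\beta\omega$ is the Čech–Stone compactification of the discrete space $\omega$ of natural numbers; $\overline A$ is the closure of $A\subseteq\omega$ in $\beta\omega$. $\lim_p x_n$ denotes the limit of a bounded real sequence $(x_n)$ along the ultrafilter $p$, and a natural number $n$ is identified with $\{0,\dots,n-1\}$. Every (nonnegative, finite) finitely additive measure $\mu$ on $\mathcal P(\omega)$ corresponds to a unique Radon measure $\widehat\mu$ on $\beta\omega$ with $\mu(A)=\widehat\mu(\overline A)$ for all $A\subseteq\omega$. For a compact space $K$, $C(K)$ is the Banach space of continuous real-valued functions on $K$ with the supremum norm; $\tau_p$ is the topology of pointwise convergence on $C(K)$ and $weak$ is the weak topology of the Banach space $C(K)$. (The letter $p$ in $\tau_p$ stands for "pointwise" and is unrelated to the ultrafilter.) $Borel(X,\tau)$ is the $\sigma$-algebra generated by the $\tau$-open sets. *)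

theory Defs
  imports "HOL-Analysis.Analysis"
begin

section \<open>The space of ultrafilters on the natural numbers\<close>

definition ultrafilter :: "'a filter \<Rightarrow> bool" where
  "ultrafilter F \<longleftrightarrow> F \<noteq> bot \<and> (\<forall>P. eventually P F \<or> eventually (\<lambda>x. \<not> P x) F)"

lemma ultrafilter_principal: "ultrafilter (principal {x})"
  by (simp add: ultrafilter_def eventually_principal principal_eq_bot_iff)

text \<open>
  The Cech-Stone compactification of the discrete space of natural numbers, realised as its
  Stone space. A set \<open>A\<close> belongs to an ultrafilter \<open>F\<close> iff \<open>\<forall>\<^sub>F n in F. n \<in> A\<close>.
\<close>

typedef beta_omega = "{F :: nat filter. ultrafilter F}"
  morphisms filter_of Abs_beta_omega
  by (rule exI[of _ "principal {0}"]) (simp add: ultrafilter_principal)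

definition point :: "nat \<Rightarrow> beta_omega" where
  "point n = Abs_beta_omega (principal {n})"

definition basic_clopen :: "nat set \<Rightarrow> beta_omega set" where
  "basic_clopen A = {p. \<forall>\<^sub>F n in filter_of p. n \<in> A}"

instantiation beta_omega :: topological_space
begin

definition open_beta_omega :: "beta_omega set \<Rightarrow> bool" where
  "open_beta_omega U \<longleftrightarrow> (\<forall>p\<in>U. \<exists>A. p \<in> basic_clopen A \<and> basic_clopen A \<subseteq> U)"

instance
proof
  show "open (UNIV :: beta_omega set)"
    unfolding open_beta_omega_def basic_clopen_def by (auto intro!: exI[of _ UNIV])
next
  fix S T :: "beta_omega set"
  assume S: "open S" and T: "open T"
  show "open (S \<inter> T)"
    unfolding open_beta_omega_def
  proof
    fix p assume "p \<in> S \<inter> T"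
    then obtain A B where "p \<in> basic_clopen A" "basic_clopen A \<subseteq> S"
      "p \<in> basic_clopen B" "basic_clopen B \<subseteq> T"
      using S T unfolding open_beta_omega_def by blast
    moreover have "basic_clopen (A \<inter> B) = basic_clopen A \<inter> basic_clopen B"
      by (auto simp: basic_clopen_def eventually_conj_iff)
    ultimately show "\<exists>C. p \<in> basic_clopen C \<and> basic_clopen C \<subseteq> S \<inter> T"
      by (intro exI[of _ "A \<inter> B"]) auto
  qed
next
  fix K :: "beta_omega set set"
  assume "\<forall>S\<in>K. open S"
  then show "open (\<Union>K)"
    unfolding open_beta_omega_def by (meson Sup_upper Union_iff order_trans)
qed

end

lemma ultrafilter_filter_of: "ultrafilter (filter_of p)"
  using filter_of by simp

lemma basic_clopen_Compl: "basic_clopen (- A) = - basic_clopen A"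
proof -
  have "eventually (\<lambda>n. n \<notin> A) (filter_of p) \<longleftrightarrow> \<not> eventually (\<lambda>n. n \<in> A) (filter_of p)" for p
    using ultrafilter_filter_of[of p] unfolding ultrafilter_def
    by (metis (mono_tags) eventually_frequently frequently_def)
  then show ?thesis
    by (auto simp: basic_clopen_def)
qed

lemma open_basic_clopen: "open (basic_clopen A)"
  by (auto simp: open_beta_omega_def)

lemma closed_basic_clopen: "closed (basic_clopen A)"
  by (metis basic_clopen_Compl closed_def open_basic_clopen)

instance beta_omega :: t2_space
proof
  fix p q :: beta_omega
  assume "p \<noteq> q"
  then have "filter_of p \<noteq> filter_of q"
    by (simp add: filter_of_inject)
  then obtain P where
    "eventually P (filter_of p) \<longleftrightarrow> \<not> eventually P (filter_of q)"
    unfolding filter_eq_iff by blast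
  then have *: "p \<in> basic_clopen {n. P n} \<longleftrightarrow> q \<notin> basic_clopen {n. P n}"
    by (auto simp: basic_clopen_def)
  let ?A = "basic_clopen {n. P n}"
  have o: "open ?A" "open (- ?A)"
    using open_basic_clopen closed_basic_clopen by (auto simp: open_closed)
  show "\<exists>U V. open U \<and> open V \<and> p \<in> U \<and> q \<in> V \<and> U \<inter> V = {}"
  proof (cases "p \<in> ?A")
    case True
    with * o show ?thesis by (intro exI[of _ ?A] exI[of _ "- ?A"]) auto
  next
    case False
    with * o show ?thesis by (intro exI[of _ "- ?A"] exI[of _ ?A]) auto
  qed
qed

lemma filter_of_point: "filter_of (point n) = principal {n}"
  by (simp add: point_def Abs_beta_omega_inverse ultrafilter_principal)

lemma closure_point_image: "closure (point ` A) = basic_clopen A"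
proof
  have "point ` A \<subseteq> basic_clopen A"
    by (auto simp: basic_clopen_def filter_of_point eventually_principal)
  then show "closure (point ` A) \<subseteq> basic_clopen A"
    by (simp add: closed_basic_clopen closure_minimal)
  show "basic_clopen A \<subseteq> closure (point ` A)"
  proof
    fix p assume p: "p \<in> basic_clopen A"
    have "\<exists>q\<in>point ` A. q \<in> U" if U: "open U" "p \<in> U" for U
    proof -
      obtain B where B: "p \<in> basic_clopen B" "basic_clopen B \<subseteq> U"
        using U unfolding open_beta_omega_def by blast
      have "eventually (\<lambda>n. n \<in> A \<and> n \<in> B) (filter_of p)"
        using p B by (simp add: basic_clopen_def eventually_conj_iff)
      moreover have "filter_of p \<noteq> bot"
        using ultrafilter_filter_of by (simp add: ultrafilter_def)
      ultimately obtain n where "n \<in> A" "n \<in> B"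
        using eventually_happens by blast
      then have "point n \<in> basic_clopen B"
        by (simp add: basic_clopen_def filter_of_point eventually_principal)
      then show ?thesis
        using B \<open>n \<in> A\<close> by blast
    qed
    then show "p \<in> closure (point ` A)"
      by (auto simp: closure_iff_nhds_not_empty)
  qed
qed

lemma compact_UNIV_beta_omega: "compact (UNIV :: beta_omega set)"
proof -
  define X where "X = product_topology (\<lambda>_ :: nat set. discrete_topology (UNIV :: bool set)) UNIV"
  define S where "S = {g :: nat set \<Rightarrow> bool. g UNIV \<and> (\<forall>A. g (- A) \<longleftrightarrow> \<not> g A) \<and> (\<forall>A B. g (A \<inter> B) \<longleftrightarrow> g A \<and> g B)}"
  define h where "h g = Abs_beta_omega (Abs_filter (\<lambda>P. g {n. P n}))" for g :: "nat set \<Rightarrow> bool"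
  have ev: "eventually P (filter_of (h g)) \<longleftrightarrow> g {n. P n}" if "g \<in> S" for g P
  proof -
    let ?F = "Abs_filter (\<lambda>P. g {n. P n})"
    have mono: "g B" if "g A" "A \<subseteq> B" for A B
      using \<open>g \<in> S\<close> that unfolding S_def by (metis (mono_tags, lifting) inf.absorb1 mem_Collect_eq)
    have e: "eventually P ?F \<longleftrightarrow> g {n. P n}" for P
    proof (rule eventually_Abs_filter, unfold_locales)
      show "g {n. True}" using \<open>g \<in> S\<close> by (simp add: S_def)
      show "g {n. P n \<and> Q n}" if "g {n. P n}" "g {n. Q n}" for P Q
        using that \<open>g \<in> S\<close> by (simp add: S_def Collect_conj_eq)
      show "g {n. Q n}" if "\<forall>n. P n \<longrightarrow> Q n" "g {n. P n}" for P Q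
        using mono that by blast
    qed
    have "ultrafilter ?F"
    proof -
      have 1: "g UNIV" "\<And>A. g (- A) \<longleftrightarrow> \<not> g A"
        using \<open>g \<in> S\<close> by (auto simp: S_def)
      from 1(1) 1(2)[of UNIV] have "\<not> g {}" by simp
      with 1(2) show ?thesis
        by (auto simp: ultrafilter_def trivial_limit_def e Collect_neg_eq)
    qed
    then show ?thesis
      by (simp add: h_def Abs_beta_omega_inverse e)
  qed
  have c: "continuous_map X (discrete_topology UNIV) (\<lambda>g. g A)" for A
    unfolding X_def by (rule continuous_map_product_projection) simp
  have cl: "openin X {g. g A}" for A
  proof -
    have "openin X {g \<in> topspace X. g A \<in> {True}}"
      by (rule openin_continuous_map_preimage[OF c]) simp
    then show ?thesis by (simp add: X_def)
  qed
  have cl': "openin X {g. \<not> g A}" for A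
  proof -
    have "openin X {g \<in> topspace X. g A \<in> {False}}"
      by (rule openin_continuous_map_preimage[OF c]) simp
    then show ?thesis by (simp add: X_def)
  qed
  have topX: "topspace X = UNIV" by (simp add: X_def)
  have "openin X (- S)"
  proof -
    have "- S = {g. \<not> g UNIV} \<union> (\<Union>A. ({g. g (- A)} \<inter> {g. g A}) \<union> ({g. \<not> g (- A)} \<inter> {g. \<not> g A}))
      \<union> (\<Union>A. \<Union>B. ({g. g (A \<inter> B)} \<inter> ({g. \<not> g A} \<union> {g. \<not> g B}))
             \<union> ({g. \<not> g (A \<inter> B)} \<inter> ({g. g A} \<inter> {g. g B})))"
      unfolding S_def by auto
    also have "openin X \<dots>"
      by (intro openin_Un openin_Union openin_Int cl cl' ballI) (auto intro!: openin_Un openin_Union openin_Int cl cl')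
    finally show ?thesis .
  qed
  then have "closedin X S"
    by (simp add: closedin_def topX Compl_eq_Diff_UNIV)
  moreover have "compact_space X"
    unfolding X_def by (simp add: compact_space_product_topology compact_space_discrete_topology)
  ultimately have S: "compactin X S"
    using closedin_compact_space by blast
  have "continuous_map (subtopology X S) euclidean h"
    unfolding continuous_map_def
  proof (intro conjI allI impI)
    fix U :: "beta_omega set" assume "openin euclidean U"
    then have U: "open U" by simp
    have "{g \<in> topspace (subtopology X S). h g \<in> U} = (\<Union>A\<in>{A. basic_clopen A \<subseteq> U}. {g. g A}) \<inter> S"
      using U ev by (fastforce simp: topX open_beta_omega_def basic_clopen_def)
    then show "openin (subtopology X S) {g \<in> topspace (subtopology X S). h g \<in> U}"
      unfolding openin_subtopology using cl by (intro exI conjI) (auto intro!: openin_Union)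
  qed auto
  then have "compactin euclidean (h ` S)"
    using S by (meson compactin_subtopology image_compactin order_refl)
  moreover have "h ` S = UNIV"
  proof -
    have "p \<in> h ` S" for p
    proof
      let ?g = "\<lambda>A. p \<in> basic_clopen A"
      show g: "?g \<in> S"
        unfolding S_def using basic_clopen_Compl
        by (auto simp: basic_clopen_def eventually_conj_iff)
      show "p = h ?g"
        unfolding filter_of_inject[symmetric] filter_eq_iff ev[OF g]
        by (simp add: basic_clopen_def)
    qed
    then show ?thesis by auto
  qed
  ultimately show ?thesis by simp
qed

definition ultrafilter_density :: "beta_omega \<Rightarrow> nat set \<Rightarrow> real" where
  "ultrafilter_density p A =
     Lim (filter_of p) (\<lambda>n. real (card (A \<inter> {0..<n})) / real n)"


lemma ultrafilter_lim:
  fixes f :: "'a \<Rightarrow> real"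
  assumes F: "ultrafilter F" and f: "\<And>x. f x \<in> {a..b}"
  shows "(f \<longlongrightarrow> Lim F f) F"
proof -
  have F': "F \<noteq> bot"
    using F by (simp add: ultrafilter_def)
  have "filtermap f F \<noteq> bot" "eventually (\<lambda>y. y \<in> {a..b}) (filtermap f F)"
    using F' f by (auto simp: filtermap_bot_iff eventually_filtermap)
  then obtain l where l: "inf (nhds l) (filtermap f F) \<noteq> bot"
    using compact_Icc[of a b] unfolding compact_filter by blast
  have "(f \<longlongrightarrow> l) F"
  proof (rule topological_tendstoI, rule ccontr)
    fix S assume S: "open S" "l \<in> S" "\<not> eventually (\<lambda>x. f x \<in> S) F"
    then have "eventually (\<lambda>x. f x \<notin> S) F"
      using F by (auto simp: ultrafilter_def)
    then have "eventually (\<lambda>y. y \<notin> S) (filtermap f F)"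
      by (simp add: eventually_filtermap)
    moreover have "eventually (\<lambda>y. y \<in> S) (nhds l)"
      using S by (simp add: eventually_nhds_in_open)
    ultimately have "eventually (\<lambda>y. False) (inf (nhds l) (filtermap f F))"
      unfolding eventually_inf by blast
    with l show False
      by (simp add: trivial_limit_def)
  qed
  then show ?thesis
    using tendsto_Lim[OF F'] by blast
qed

lemma tendsto_ultrafilter_density:
  "((\<lambda>n. real (card (A \<inter> {0..<n})) / real n) \<longlongrightarrow> ultrafilter_density p A) (filter_of p)"
  unfolding ultrafilter_density_def
proof (rule ultrafilter_lim[OF ultrafilter_filter_of])
  fix n
  have "card (A \<inter> {0..<n}) \<le> n"
    using card_mono[of "{0..<n}" "A \<inter> {0..<n}"] by simp
  then show "real (card (A \<inter> {0..<n})) / real n \<in> {0..1}"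
    by (cases "n = 0") (auto simp: divide_le_eq_1)
qed

section \<open>Measures, topologies and Borel structures\<close>

definition radon_measure :: "'a :: t2_space measure \<Rightarrow> bool" where
  "radon_measure M \<longleftrightarrow> finite_measure M \<and> sets M = sets borel \<and>
     (\<forall>A\<in>sets M. emeasure M A = (SUP K\<in>{K. compact K \<and> K \<subseteq> A}. emeasure M K))"

text \<open>
  The space \<open>C(K)\<close> for compact \<open>K\<close> is the type \<open>K \<Rightarrow>\<^sub>C real\<close> of bounded continuous functions,
  whose norm is the supremum norm: on a compact space boundedness is automatic.
\<close>

lemma continuous_on_beta_omega_bcontfun:
  fixes f :: "beta_omega \<Rightarrow> real"
  shows "continuous_on UNIV f \<longleftrightarrow> f \<in> bcontfun"
  unfolding bcontfun_def
  using compact_imp_bounded[OF compact_continuous_image[OF _ compact_UNIV_beta_omega]] by auto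

definition initial_topology :: "('a \<Rightarrow> real) set \<Rightarrow> 'a topology" where
  "initial_topology \<Phi> = topology_generated_by {\<phi> -` U | \<phi> U. \<phi> \<in> \<Phi> \<and> open U}"

definition pointwise_topology :: "('a :: topological_space \<Rightarrow>\<^sub>C real) topology" where
  "pointwise_topology = initial_topology (range (\<lambda>x f. apply_bcontfun f x))"

definition weak_topology :: "'a :: real_normed_vector topology" where
  "weak_topology = initial_topology {\<phi>. bounded_linear \<phi>}"

definition borel_of :: "'a topology \<Rightarrow> 'a measure" where
  "borel_of T = sigma (topspace T) {U. openin T U}"

lemma topspace_initial_topology: "\<Phi> \<noteq> {} \<Longrightarrow> topspace (initial_topology \<Phi>) = UNIV"
proof -
  assume "\<Phi> \<noteq> {}"
  then obtain \<phi> where "\<phi> \<in> \<Phi>" by blast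
  then have "UNIV \<in> {\<phi> -` U | \<phi> U. \<phi> \<in> \<Phi> \<and> open U}"
    by (metis (mono_tags, lifting) mem_Collect_eq open_UNIV vimage_UNIV)
  then show ?thesis
    unfolding initial_topology_def topology_generated_by_topspace by blast
qed

lemma sets_borel_of: "sets (borel_of T) = sigma_sets (topspace T) {U. openin T U}"
proof -
  have "{U. openin T U} \<subseteq> Pow (topspace T)"
    using openin_subset by blast
  then show ?thesis
    by (simp add: borel_of_def)
qed

end

theory Submission
  imports Defs
begin

text \<open>
  Identify a set \<open>A\<close> of natural numbers with the indicator of its closure; the pointwise topology
  then becomes the topology generated by the sets \<open>{A. A \<in> q}\<close> for ultrafilters \<open>q\<close>. Finitely
  many ultrafilters always have a common member of small upper density, since each of them contains
  a residue class modulo \<open>m\<close>. Hence a pointwise open set is decided by prescribing \<open>A\<close> on a set of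
  small upper density: every condition of this kind extends to one that forces membership, or else
  already excludes it. Borel sets therefore pull back to sets with the Baire property in the
  space of decreasing sequences of conditions. On the other hand, a fusion argument shows that every
  comeager subset of a nonempty open set of sequences contains sequences whose limit sets have
  density at most \<open>1/4\<close>, and others with density at least \<open>3/4\<close>, so \<open>{A. d\<^sub>p(A) < 1/2}\<close> does not
  pull back to a set with the Baire property. The Baire property has to be taken for sequences of
  conditions: the sets of natural numbers with the topology above are meager in themselves.

  The weak topology makes the functional \<open>f \<mapsto> lim\<^sub>p (f(0) + \<dots> + f(n - 1)) / n\<close>
  continuous, and it takes the value \<open>d\<^sub>p(A)\<close> at the indicator of the closure of \<open>A\<close>.
\<close>

section \<open>Sets with the Baire property\<close>

definition dense_openin :: "'a topology \<Rightarrow> 'a set \<Rightarrow> bool" where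
  "dense_openin X G \<longleftrightarrow> openin X G \<and> (\<forall>H. openin X H \<and> H \<noteq> {} \<longrightarrow> H \<inter> G \<noteq> {})"

text \<open>The comeager set is given by a sequence of dense open sets. Points outside
  \<open>topspace X\<close> are ignored, so \<open>B\<close> may be any set and complements can be
  taken in the whole type.\<close>

definition baire_property :: "'a topology \<Rightarrow> 'a set \<Rightarrow> bool" where
  "baire_property X B \<longleftrightarrow> (\<exists>U G. openin X U \<and> (\<forall>n::nat. dense_openin X (G n)) \<and>
     (\<forall>x\<in>topspace X. (\<forall>n. x \<in> G n) \<longrightarrow> (x \<in> B \<longleftrightarrow> x \<in> U)))"

lemma baire_property_Compl:
  assumes "baire_property X B"
  shows "baire_property X (- B)"
proof -
  obtain U G where U: "openin X U" and G: "\<And>n::nat. dense_openin X (G n)"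
    and B: "\<And>x. x \<in> topspace X \<Longrightarrow> \<forall>n. x \<in> G n \<Longrightarrow> x \<in> B \<longleftrightarrow> x \<in> U"
    using assms unfolding baire_property_def by blast
  \<comment> \<open>The exterior of \<open>U\<close>: only the nowhere dense boundary of
    \<open>U\<close> escapes \<open>U \<union> V\<close>, which can therefore join the sequence of
    dense open sets.\<close>
  define V where "V = \<Union>{H. openin X H \<and> H \<inter> U = {}}"
  have V: "openin X V" unfolding V_def by blast
  have "dense_openin X (U \<union> V)"
    unfolding dense_openin_def
  proof (intro conjI allI impI)
    show "openin X (U \<union> V)" using U V by blast
    fix H assume "openin X H \<and> H \<noteq> {}"
    then show "H \<inter> (U \<union> V) \<noteq> {}" unfolding V_def by blast
  qed
  then have "\<forall>n. dense_openin X (case n of 0 \<Rightarrow> U \<union> V | Suc m \<Rightarrow> G m)"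
    using G by (simp split: nat.split)
  moreover have "x \<in> - B \<longleftrightarrow> x \<in> V"
    if "x \<in> topspace X" "\<forall>n. x \<in> (case n of 0 \<Rightarrow> U \<union> V | Suc m \<Rightarrow> G m)" for x
  proof -
    have "x \<in> U \<union> V" using that(2)[rule_format, of 0] by simp
    moreover have "\<forall>n. x \<in> G n" using that(2)[rule_format, of "Suc _"] by simp
    moreover have "U \<inter> V = {}" unfolding V_def by blast
    ultimately show ?thesis using B[OF that(1)] by blast
  qed
  ultimately show ?thesis using V unfolding baire_property_def by blast
qed

lemma baire_property_UN:
  assumes "\<And>i::nat. baire_property X (B i)"
  shows "baire_property X (\<Union>i. B i)"
proof -
  obtain U G where U: "\<And>i. openin X (U i)" and G: "\<And>i n::nat. dense_openin X (G i n)"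
    and B: "\<And>i x. x \<in> topspace X \<Longrightarrow> \<forall>n. x \<in> G i n \<Longrightarrow> x \<in> B i \<longleftrightarrow> x \<in> U i"
    using assms unfolding baire_property_def by metis
  define H where "H n = (\<lambda>(i, m). G i m) (prod_decode n)" for n
  have "x \<in> (\<Union>i. B i) \<longleftrightarrow> x \<in> (\<Union>i. U i)" if "x \<in> topspace X" "\<forall>n. x \<in> H n" for x
  proof -
    have "x \<in> G i m" for i m
      using that(2)[rule_format, of "prod_encode (i, m)"] by (simp add: H_def)
    then have "x \<in> B i \<longleftrightarrow> x \<in> U i" for i using B[OF that(1)] by simp
    then show ?thesis by simp
  qed
  moreover have "openin X (\<Union>i. U i)" using U by blast
  moreover have "dense_openin X (H n)" for n
    using G by (simp add: H_def split: prod.split)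
  ultimately show ?thesis
    unfolding baire_property_def by (intro exI[of _ "\<Union>i. U i"] exI[of _ H]) simp
qed

lemma baire_property_empty: "baire_property X {}"
  unfolding baire_property_def dense_openin_def
  by (rule exI[of _ "{}"], rule exI[of _ "\<lambda>_. topspace X"]) (use openin_subset in fastforce)

section \<open>Chains of conditions\<close>

text \<open>Upper density below 1/8, written as a linear bound. The strict inequality leaves room
  for adjoining further thin sets.\<close>

definition sparse :: "nat set \<Rightarrow> bool" where
  "sparse X \<longleftrightarrow> (\<exists>N \<delta>. \<delta> < 1/8 \<and> (\<forall>k. real (card (X \<inter> {..<k})) \<le> N + \<delta> * real k))"

text \<open>A pair \<open>(X, A)\<close> stands for the condition that a set coincide with \<open>A\<close> on \<open>X\<close>.\<close>

definition chains :: "(nat \<Rightarrow> nat set \<times> nat set) set" where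
  "chains = {f. \<forall>n. sparse (fst (f n)) \<and> fst (f n) \<subseteq> fst (f (Suc n)) \<and>
                    snd (f (Suc n)) \<inter> fst (f n) = snd (f n) \<inter> fst (f n)}"

definition limit_set :: "(nat \<Rightarrow> nat set \<times> nat set) \<Rightarrow> nat set" where
  "limit_set f = (\<Union>n. snd (f n) \<inter> fst (f n))"

definition cylinder :: "(nat \<Rightarrow> nat set \<times> nat set) \<Rightarrow> nat \<Rightarrow> (nat \<Rightarrow> nat set \<times> nat set) set" where
  "cylinder f n = {g \<in> chains. \<forall>i\<le>n. g i = f i}"

text \<open>The topology inherited from a countable product of discrete spaces.\<close>

definition chain_topology :: "(nat \<Rightarrow> nat set \<times> nat set) topology" where
  "chain_topology = topology (\<lambda>U. U \<subseteq> chains \<and> (\<forall>f\<in>U. \<exists>n. cylinder f n \<subseteq> U))"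

lemma openin_chain_topology:
  "openin chain_topology U \<longleftrightarrow> U \<subseteq> chains \<and> (\<forall>f\<in>U. \<exists>n. cylinder f n \<subseteq> U)"
proof -
  have "istopology (\<lambda>U. U \<subseteq> chains \<and> (\<forall>f\<in>U. \<exists>n. cylinder f n \<subseteq> U))"
    unfolding istopology_def
  proof (intro conjI allI impI ballI; (elim conjE)?)
    fix S T f
    assume "\<forall>f\<in>S. \<exists>n. cylinder f n \<subseteq> S" "\<forall>f\<in>T. \<exists>n. cylinder f n \<subseteq> T" "f \<in> S \<inter> T"
    then obtain m n where "cylinder f m \<subseteq> S" "cylinder f n \<subseteq> T" by blast
    moreover have "cylinder f (max m n) \<subseteq> cylinder f m \<inter> cylinder f n"
      by (auto simp: cylinder_def)
    ultimately show "\<exists>n. cylinder f n \<subseteq> S \<inter> T" by blast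
  next
    fix K f
    assume "\<forall>U\<in>K. U \<subseteq> chains \<and> (\<forall>f\<in>U. \<exists>n. cylinder f n \<subseteq> U)" "f \<in> \<Union> K"
    then show "\<exists>n. cylinder f n \<subseteq> \<Union> K" by (meson Sup_upper Union_iff order_trans)
  qed auto
  then show ?thesis
    by (simp add: chain_topology_def)
qed

lemma topspace_chain_topology: "topspace chain_topology = chains"
proof (rule antisym)
  show "topspace chain_topology \<subseteq> chains"
    using openin_topspace openin_chain_topology by blast
  have "openin chain_topology chains"
    unfolding openin_chain_topology by (auto simp: cylinder_def)
  then show "chains \<subseteq> topspace chain_topology" by (rule openin_subset)
qed

lemma openin_cylinder: "openin chain_topology (cylinder f n)"
  unfolding openin_chain_topology
  by (auto simp: cylinder_def intro!: exI[of _ n])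

lemma openin_chains_ex: "openin chain_topology {f \<in> chains. \<exists>n. P (f n)}"
  unfolding openin_chain_topology
proof (intro conjI ballI)
  fix f assume "f \<in> {f \<in> chains. \<exists>n. P (f n)}"
  then obtain n where "P (f n)" by blast
  then have "g \<in> chains \<and> P (g n)" if "g \<in> cylinder f n" for g
    using that by (simp add: cylinder_def)
  then have "cylinder f n \<subseteq> {f \<in> chains. \<exists>n. P (f n)}" by blast
  then show "\<exists>n. cylinder f n \<subseteq> {f \<in> chains. \<exists>n. P (f n)}" by blast
qed blast

lemma chains_mono:
  assumes "f \<in> chains" "m \<le> n"
  shows "fst (f m) \<subseteq> fst (f n) \<and> snd (f n) \<inter> fst (f m) = snd (f m) \<inter> fst (f m)"
  using assms(2)
proof (induction n rule: dec_induct)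
  case (step n)
  then show ?case using assms(1) unfolding chains_def by blast
qed auto

text \<open>Later conditions agree with earlier ones on the earlier domains, so nothing prescribed
  along the chain conflicts with stage \<open>n\<close>.\<close>

lemma limit_set_Int:
  assumes "f \<in> chains"
  shows "limit_set f \<inter> fst (f n) = snd (f n) \<inter> fst (f n)"
proof -
  have "x \<in> snd (f n)" if "x \<in> snd (f m)" "x \<in> fst (f m)" "x \<in> fst (f n)" for x m
    using chains_mono[OF assms, of m n] chains_mono[OF assms, of n m] that
    by (cases "m \<le> n") (auto simp: set_eq_iff)
  then show ?thesis unfolding limit_set_def by auto
qed

lemma extend_chain:
  assumes "f \<in> chains" "sparse X" "fst (f n) \<subseteq> X" "A \<inter> fst (f n) = snd (f n) \<inter> fst (f n)"
  shows "(\<lambda>i. if i \<le> n then f i else (X, A)) \<in> cylinder f n"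
  using assms unfolding cylinder_def chains_def
  by (auto simp: not_less_eq_eq le_Suc_eq dest: antisym)

text \<open>Completeness of the space of chains, which supplies the points that a category argument
  needs.\<close>

lemma cylinder_limit:
  assumes "\<And>j. u j \<in> chains" "\<And>j. u (Suc j) \<in> cylinder (u j) (n j)" "\<And>j. n j < n (Suc j)"
  obtains F where "\<And>j. F \<in> cylinder (u j) (n j)"
proof
  have n: "strict_mono n" using assms(3) by (simp add: strict_mono_Suc_iff)
  have le: "i \<le> n i" for i using n by (rule strict_mono_imp_increasing)
  have eq: "u k i = u j i" if "j \<le> k" "i \<le> n j" for i j k
    using that(1)
  proof (induction k rule: dec_induct)
    case (step k)
    have "i \<le> n k" using step that n by (meson order_trans strict_mono_less_eq)
    then show ?case using assms(2)[of k] step by (simp add: cylinder_def)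
  qed simp
  \<comment> \<open>The diagonal is consistent because \<open>i \<le> n i\<close>: from stage
    \<open>i\<close> on, the entry at index \<open>i\<close> is frozen.\<close>
  define F where "F i = u i i" for i
  have F: "F i = u j i" if "i \<le> n j" for i j
    using eq[of i j i] eq[of j i i] that le[of i] unfolding F_def by (cases "i \<le> j") auto
  have "F \<in> chains"
    unfolding chains_def
  proof (intro CollectI allI)
    fix i
    have "F i = u (Suc i) i" "F (Suc i) = u (Suc i) (Suc i)"
      using F le[of "Suc i"] by auto
    then show "sparse (fst (F i)) \<and> fst (F i) \<subseteq> fst (F (Suc i)) \<and>
        snd (F (Suc i)) \<inter> fst (F i) = snd (F i) \<inter> fst (F i)"
      using assms(1)[of "Suc i"] unfolding chains_def by auto
  qed
  then show "F \<in> cylinder (u j) (n j)" for j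
    using F by (auto simp: cylinder_def)
qed

section \<open>Enlarging sparse sets to members of given ultrafilters\<close>

lemma sparse_Un:
  assumes "sparse X" and *: "\<And>\<epsilon>. \<epsilon> > 0 \<Longrightarrow> \<exists>Z N. Z \<in> \<Z> \<and> (\<forall>k. real (card (Z \<inter> {..<k})) \<le> N + \<epsilon> * real k)"
  shows "\<exists>Z\<in>\<Z>. sparse (X \<union> Z)"
proof -
  obtain N \<delta> where X: "\<delta> < 1/8" "\<And>k. real (card (X \<inter> {..<k})) \<le> N + \<delta> * real k"
    using assms(1) unfolding sparse_def by blast
  \<comment> \<open>Half of the slack, so that the new slope \<open>\<delta> + \<epsilon>\<close>
    stays strictly below 1/8.\<close>
  define \<epsilon> where "\<epsilon> = (1/8 - \<delta>) / 2"
  obtain Z M where Z: "Z \<in> \<Z>" "\<And>k. real (card (Z \<inter> {..<k})) \<le> M + \<epsilon> * real k"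
    using *[of \<epsilon>] X(1) by (auto simp: \<epsilon>_def)
  have "real (card ((X \<union> Z) \<inter> {..<k})) \<le> (N + M) + (\<delta> + \<epsilon>) * real k" for k
  proof -
    have "card ((X \<union> Z) \<inter> {..<k}) \<le> card (X \<inter> {..<k}) + card (Z \<inter> {..<k})"
      by (simp add: Int_Un_distrib2 card_Un_le)
    then show ?thesis using X(2)[of k] Z(2)[of k] by (simp add: algebra_simps)
  qed
  moreover have "\<delta> + \<epsilon> < 1/8" using X(1) by (simp add: \<epsilon>_def field_simps)
  ultimately show ?thesis using Z(1) unfolding sparse_def by blast
qed

lemma sparse_Un_lessThan:
  assumes "sparse X"
  shows "sparse (X \<union> {..<b})"
proof -
  have "\<exists>Z\<in>{{..<b}}. sparse (X \<union> Z)"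
  proof (rule sparse_Un[OF assms])
    fix \<epsilon> :: real assume "\<epsilon> > 0"
    have "card ({..<b} \<inter> {..<k}) \<le> b" for k
      using card_mono[of "{..<b}" "{..<b} \<inter> {..<k}"] by simp
    then have "\<forall>k. real (card ({..<b} \<inter> {..<k})) \<le> real b + \<epsilon> * real k"
      using \<open>\<epsilon> > 0\<close> by (simp add: add_increasing2)
    then show "\<exists>Z N. Z \<in> {{..<b}} \<and> (\<forall>k. real (card (Z \<inter> {..<k})) \<le> N + \<epsilon> * real k)"
      by blast
  qed
  then show ?thesis by simp
qed

lemma card_residue_class_le:
  fixes m r k :: nat
  assumes "0 < m"
  shows "card ({n. n mod m = r} \<inter> {..<k}) \<le> k div m + 1"
proof -
  have "inj_on (\<lambda>n. n div m) ({n. n mod m = r} \<inter> {..<k})"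
    by (rule inj_onI) (metis (mono_tags, lifting) IntD1 div_mult_mod_eq mem_Collect_eq)
  moreover have "(\<lambda>n. n div m) ` ({n. n mod m = r} \<inter> {..<k}) \<subseteq> {..k div m}"
    by (auto simp: div_le_mono)
  ultimately have "card ({n. n mod m = r} \<inter> {..<k}) \<le> card {..k div m}"
    by (rule card_inj_on_le) simp
  then show ?thesis by simp
qed

text \<open>Finitely many residue classes cover the natural numbers, so an ultrafilter cannot omit
  all of them.\<close>

lemma residue_class_in_ultrafilter:
  assumes "0 < m"
  shows "\<exists>r. q \<in> basic_clopen {n. n mod m = r}"
proof (rule ccontr)
  assume "\<not> ?thesis"
  then have "q \<in> - basic_clopen {n. n mod m = r}" for r by blast
  then have "\<forall>\<^sub>F n in filter_of q. n mod m \<noteq> r" for r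
    unfolding basic_clopen_Compl[symmetric] by (simp add: basic_clopen_def)
  then have "\<forall>\<^sub>F n in filter_of q. \<forall>r\<in>{..<m}. n mod m \<noteq> r"
    by (intro eventually_ball_finite) auto
  then have "\<forall>\<^sub>F n in filter_of q. False"
    by (rule eventually_mono) (use assms in auto)
  then show False
    using ultrafilter_filter_of[of q] by (simp add: ultrafilter_def)
qed

text \<open>Residue classes modulo large \<open>m\<close> are members of \<open>q\<close> as thin as
  the slack of \<open>X\<close> demands.\<close>

lemma sparse_Un_ultrafilter:
  assumes "sparse X"
  shows "\<exists>Z. q \<in> basic_clopen Z \<and> sparse (X \<union> Z)"
proof -
  have "\<exists>Z\<in>{Z. q \<in> basic_clopen Z}. sparse (X \<union> Z)"
  proof (rule sparse_Un[OF assms])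
    fix \<epsilon> :: real assume "\<epsilon> > 0"
    then obtain m where m: "0 < m" "1 / real m < \<epsilon>"
      by (metis nat_approx_posE zero_less_Suc of_nat_Suc)
    obtain r where r: "q \<in> basic_clopen {n. n mod m = r}"
      using residue_class_in_ultrafilter[OF m(1)] by blast
    have "real (card ({n. n mod m = r} \<inter> {..<k})) \<le> 1 + \<epsilon> * real k" for k
    proof -
      have "real (card ({n. n mod m = r} \<inter> {..<k})) \<le> real (k div m) + 1"
        using card_residue_class_le[OF m(1), of r k] by linarith
      also have "real (k div m) \<le> 1 / real m * real k"
        using of_nat_div_le_of_nat[of k m, where 'a = real] by simp
      also have "\<dots> \<le> \<epsilon> * real k" using m(2) by (intro mult_right_mono) auto
      finally show ?thesis by simp
    qed
    then show "\<exists>Z N. Z \<in> {Z. q \<in> basic_clopen Z} \<and> (\<forall>k. real (card (Z \<inter> {..<k})) \<le> N + \<epsilon> * real k)"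
      using r by blast
  qed
  then show ?thesis by blast
qed

lemma basic_clopen_mono: "A \<subseteq> B \<Longrightarrow> basic_clopen A \<subseteq> basic_clopen B"
  unfolding basic_clopen_def by (auto elim: eventually_mono)

lemma sparse_superset_ultrafilters:
  assumes "finite Q" "sparse X"
  shows "\<exists>X'. X \<subseteq> X' \<and> sparse X' \<and> (\<forall>q\<in>Q. q \<in> basic_clopen X')"
  using assms
proof (induction Q)
  case (insert q Q)
  then obtain X' where X': "X \<subseteq> X'" "sparse X'" "\<forall>q\<in>Q. q \<in> basic_clopen X'" by blast
  obtain Z where Z: "q \<in> basic_clopen Z" "sparse (X' \<union> Z)"
    using sparse_Un_ultrafilter[OF X'(2)] by blast
  then show ?case
    using X' basic_clopen_mono[of X' "X' \<union> Z"] basic_clopen_mono[of Z "X' \<union> Z"]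
    by (intro exI[of _ "X' \<union> Z"]) blast
qed auto

text \<open>This is why a condition whose domain \<open>X\<close> belongs to \<open>q\<close>
  decides membership in \<open>q\<close>.\<close>

lemma basic_clopen_cong:
  assumes "q \<in> basic_clopen X" "A \<inter> X = B \<inter> X"
  shows "q \<in> basic_clopen A \<longleftrightarrow> q \<in> basic_clopen B"
proof -
  have "\<forall>\<^sub>F n in filter_of q. n \<in> A \<longleftrightarrow> n \<in> B"
    using assms unfolding basic_clopen_def by (auto elim!: eventually_mono)
  then show ?thesis unfolding basic_clopen_def by (auto dest: eventually_elim2 simp: eventually_subst)
qed

section \<open>Pointwise Borel sets pull back to sets with the Baire property\<close>

text \<open>Openness in the topology on sets of natural numbers pulled back from the pointwise
  topology.\<close>

definition finitely_open :: "nat set set \<Rightarrow> bool" where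
  "finitely_open \<B> \<longleftrightarrow> (\<forall>A\<in>\<B>. \<exists>Q. finite Q \<and>
     (\<forall>A'. (\<forall>q\<in>Q. q \<in> basic_clopen A' \<longleftrightarrow> q \<in> basic_clopen A) \<longrightarrow> A' \<in> \<B>))"

lemma baire_property_finitely_open:
  assumes "finitely_open \<B>"
  shows "baire_property chain_topology {f. limit_set f \<in> \<B>}"
proof -
  \<comment> \<open>\<open>V\<close> and \<open>W\<close> consist of the chains that contain a
    condition forcing the limit set into, respectively out of, \<open>\<B>\<close>.\<close>
  define V where "V = {f \<in> chains. \<exists>n. \<forall>A. A \<inter> fst (f n) = snd (f n) \<inter> fst (f n) \<longrightarrow> A \<in> \<B>}"
  define W where "W = {f \<in> chains. \<exists>n. \<forall>A. A \<inter> fst (f n) = snd (f n) \<inter> fst (f n) \<longrightarrow> A \<notin> \<B>}"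
  have V: "openin chain_topology V"
    unfolding V_def by (rule openin_chains_ex)
  have W: "openin chain_topology W"
    unfolding W_def by (rule openin_chains_ex)
  have "dense_openin chain_topology (V \<union> W)"
    unfolding dense_openin_def
  proof (intro conjI allI impI)
    show "openin chain_topology (V \<union> W)" using V W by blast
    fix H assume "openin chain_topology H \<and> H \<noteq> {}"
    then obtain f n where f: "f \<in> H" "f \<in> chains" "cylinder f n \<subseteq> H"
      unfolding openin_chain_topology by blast
    show "H \<inter> (V \<union> W) \<noteq> {}"
    proof (cases "\<exists>A\<in>\<B>. A \<inter> fst (f n) = snd (f n) \<inter> fst (f n)")
      case False
      then have "f \<in> W" using f unfolding W_def by blast
      then show ?thesis using f by blast
    next
      case True
      then obtain A where A: "A \<in> \<B>" "A \<inter> fst (f n) = snd (f n) \<inter> fst (f n)" by blast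
      obtain Q where Q: "finite Q"
        "\<And>A'. \<forall>q\<in>Q. q \<in> basic_clopen A' \<longleftrightarrow> q \<in> basic_clopen A \<Longrightarrow> A' \<in> \<B>"
        using assms A(1) unfolding finitely_open_def by blast
      have "sparse (fst (f n))" using f(2) by (simp add: chains_def)
      \<comment> \<open>A domain that belongs to every ultrafilter in \<open>Q\<close> freezes the
        membership of \<open>A\<close> in each of them, so \<open>(X, A)\<close> forces membership
        in \<open>\<B>\<close>.\<close>
      then obtain X where X: "fst (f n) \<subseteq> X" "sparse X" "\<forall>q\<in>Q. q \<in> basic_clopen X"
        using sparse_superset_ultrafilters[OF Q(1)] by blast
      define h where "h = (\<lambda>i. if i \<le> n then f i else (X, A))"
      have h: "h \<in> cylinder f n"
        unfolding h_def using extend_chain f(2) X A by blast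
      have "A' \<in> \<B>" if "A' \<inter> X = A \<inter> X" for A'
        by (rule Q(2)) (use basic_clopen_cong[OF _ that] X(3) in blast)
      moreover have "h (Suc n) = (X, A)" by (simp add: h_def)
      moreover have "h \<in> chains" using h by (simp add: cylinder_def)
      ultimately have "h \<in> V"
        unfolding V_def by (intro CollectI conjI exI[of _ "Suc n"]) simp_all
      then show ?thesis using h f by blast
    qed
  qed
  moreover have "limit_set f \<in> \<B> \<longleftrightarrow> f \<in> V" if "f \<in> chains" "f \<in> V \<union> W" for f
  proof
    assume "limit_set f \<in> \<B>"
    moreover have "limit_set f \<notin> \<B>" if "f \<in> W"
    proof -
      from that obtain n where
        "\<forall>A. A \<inter> fst (f n) = snd (f n) \<inter> fst (f n) \<longrightarrow> A \<notin> \<B>"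
        unfolding W_def by blast
      then show ?thesis using limit_set_Int[OF \<open>f \<in> chains\<close>] by simp
    qed
    ultimately have "f \<notin> W" by blast
    then show "f \<in> V" using that(2) by blast
  next
    assume "f \<in> V"
    then obtain n where "\<forall>A. A \<inter> fst (f n) = snd (f n) \<inter> fst (f n) \<longrightarrow> A \<in> \<B>"
      unfolding V_def by blast
    then show "limit_set f \<in> \<B>" using limit_set_Int[OF that(1)] by simp
  qed
  ultimately show ?thesis
    unfolding baire_property_def topspace_chain_topology
    by (intro exI[of _ V] exI[of _ "\<lambda>_. V \<union> W"]) (simp add: V)
qed

section \<open>Pulling back along indicators of clopen sets\<close>

definition clopen_indicator :: "nat set \<Rightarrow> (beta_omega \<Rightarrow>\<^sub>C real)" where
  "clopen_indicator A = Bcontfun (indicator (basic_clopen A))"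

lemma apply_clopen_indicator:
  "apply_bcontfun (clopen_indicator A) x = indicator (basic_clopen A) x"
proof -
  \<comment> \<open>Continuity of an indicator can fail only on the frontier, which is empty for a
    clopen set.\<close>
  have "continuous_on UNIV (indicator (basic_clopen A) :: beta_omega \<Rightarrow> real)"
    by (simp add: continuous_on_eq_continuous_at isCont_indicator frontier_def
        closed_basic_clopen open_basic_clopen interior_open)
  then show ?thesis
    unfolding clopen_indicator_def continuous_on_beta_omega_bcontfun
    by (simp add: Bcontfun_inverse)
qed

text \<open>A subbasic set tests the value at one point \<open>x\<close>, and for
  \<open>clopen_indicator A\<close> this value depends only on whether \<open>A\<close> belongs to
  the ultrafilter \<open>x\<close>.\<close>

lemma finitely_open_vimage:
  assumes "openin pointwise_topology U"
  shows "finitely_open (clopen_indicator -` U)"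
proof -
  have "generate_topology_on
      {\<phi> -` V | \<phi> V. \<phi> \<in> range (\<lambda>x f. apply_bcontfun f x) \<and> open (V :: real set)} U"
    using assms unfolding pointwise_topology_def initial_topology_def
    by (simp add: openin_topology_generated_by_iff)
  then show ?thesis
  proof (induction U rule: generate_topology_on.induct)
    case Empty
    then show ?case by (simp add: finitely_open_def)
  next
    case (Int a b)
    show ?case
      unfolding finitely_open_def
    proof
      fix A assume A: "A \<in> clopen_indicator -` (a \<inter> b)"
      obtain Q where Q: "finite Q"
        "\<And>A'. \<forall>q\<in>Q. q \<in> basic_clopen A' \<longleftrightarrow> q \<in> basic_clopen A \<Longrightarrow> A' \<in> clopen_indicator -` a"
        using Int.IH(1) A unfolding finitely_open_def by blast
      obtain R where R: "finite R"
        "\<And>A'. \<forall>q\<in>R. q \<in> basic_clopen A' \<longleftrightarrow> q \<in> basic_clopen A \<Longrightarrow> A' \<in> clopen_indicator -` b"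
        using Int.IH(2) A unfolding finitely_open_def by blast
      show "\<exists>Q. finite Q \<and> (\<forall>A'. (\<forall>q\<in>Q. q \<in> basic_clopen A' \<longleftrightarrow> q \<in> basic_clopen A)
          \<longrightarrow> A' \<in> clopen_indicator -` (a \<inter> b))"
        by (rule exI[of _ "Q \<union> R"]) (use Q R in simp)
    qed
  next
    case (UN K)
    show ?case
      unfolding finitely_open_def
    proof
      fix A assume "A \<in> clopen_indicator -` \<Union> K"
      then obtain k where k: "k \<in> K" "A \<in> clopen_indicator -` k" by blast
      then obtain Q where Q: "finite Q"
        "\<And>A'. \<forall>q\<in>Q. q \<in> basic_clopen A' \<longleftrightarrow> q \<in> basic_clopen A \<Longrightarrow> A' \<in> clopen_indicator -` k"
        using UN.IH[OF k(1)] unfolding finitely_open_def by blast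
      show "\<exists>Q. finite Q \<and> (\<forall>A'. (\<forall>q\<in>Q. q \<in> basic_clopen A' \<longleftrightarrow> q \<in> basic_clopen A)
          \<longrightarrow> A' \<in> clopen_indicator -` \<Union> K)"
        by (rule exI[of _ Q]) (use Q k(1) in auto)
    qed
  next
    case (Basis s)
    then obtain x V where s: "s = (\<lambda>f. apply_bcontfun f x) -` V" by blast
    show ?case
      unfolding finitely_open_def s
      by (intro ballI exI[of _ "{x}"]) (auto simp: apply_clopen_indicator indicator_def)
  qed
qed

lemma topspace_pointwise_topology: "topspace pointwise_topology = UNIV"
  unfolding pointwise_topology_def by (rule topspace_initial_topology) blast

lemma topspace_weak_topology: "topspace weak_topology = UNIV"
  unfolding weak_topology_def by (rule topspace_initial_topology) (use bounded_linear_zero in blast)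

lemma baire_property_pointwise_borel:
  assumes "S \<in> sets (borel_of pointwise_topology)"
  shows "baire_property chain_topology {f. clopen_indicator (limit_set f) \<in> S}"
  using assms unfolding sets_borel_of topspace_pointwise_topology
proof (induction S rule: sigma_sets.induct)
  case (Basic U)
  then show ?case
    using baire_property_finitely_open[OF finitely_open_vimage[of U]] by simp
next
  case Empty
  then show ?case by (simp add: baire_property_empty)
next
  case (Compl S)
  have "{f. clopen_indicator (limit_set f) \<in> UNIV - S} = - {f. clopen_indicator (limit_set f) \<in> S}"
    by blast
  then show ?case using baire_property_Compl[OF Compl.IH] by simp
next
  case (Union S)
  have "{f. clopen_indicator (limit_set f) \<in> \<Union> (range S)}
      = (\<Union>i. {f. clopen_indicator (limit_set f) \<in> S i})"
    by blast
  then show ?case using baire_property_UN[OF Union.IH] by simp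
qed

section \<open>Fusion\<close>

text \<open>A pair \<open>(f, n)\<close> stands for \<open>cylinder f n\<close>. Agreement with
  \<open>T\<close> is demanded only below \<open>b\<close>, since entering \<open>G\<close> may
  decide larger numbers in an uncontrolled way.\<close>

definition refines ::
  "nat set \<Rightarrow> (nat \<Rightarrow> nat set \<times> nat set) set \<Rightarrow> nat \<Rightarrow> (nat \<Rightarrow> nat set \<times> nat set) \<times> nat
    \<Rightarrow> (nat \<Rightarrow> nat set \<times> nat set) \<times> nat \<Rightarrow> bool" where
  "refines T G b = (\<lambda>(f, n) (f', n'). f' \<in> cylinder f n \<and> n < n' \<and> cylinder f' n' \<subseteq> G \<and>
     {..<b} \<subseteq> fst (f' n') \<and> snd (f' n') \<inter> ({..<b} - fst (f n)) = T \<inter> ({..<b} - fst (f n)))"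

text \<open>The order matters: agreement with \<open>T\<close> below \<open>b\<close> is prescribed
  first, and the later extension into \<open>G\<close> cannot undo it.\<close>

lemma refines_exists:
  assumes "f \<in> chains" "dense_openin chain_topology G"
  shows "\<exists>v. refines T G b (f, n) v"
proof -
  define X where "X = fst (f n) \<union> {..<b}"
  define A where "A = (snd (f n) \<inter> fst (f n)) \<union> (T - fst (f n))"
  define h where "h = (\<lambda>i. if i \<le> n then f i else (X, A))"
  have "sparse X"
    unfolding X_def using assms(1) sparse_Un_lessThan by (simp add: chains_def)
  then have h: "h \<in> cylinder f n"
    unfolding h_def by (intro extend_chain assms(1)) (auto simp: X_def A_def)
  \<comment> \<open>Index \<open>Suc n\<close> carries the new condition \<open>(X, A)\<close>, so
    the cylinder must reach that far for it to be preserved.\<close>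
  then have "h \<in> cylinder h (Suc n)" by (simp add: cylinder_def)
  then obtain g where g: "g \<in> cylinder h (Suc n)" "g \<in> G"
    using assms(2) openin_cylinder[of h "Suc n"] unfolding dense_openin_def by blast
  then obtain k where k: "cylinder g k \<subseteq> G"
    using assms(2) unfolding dense_openin_def openin_chain_topology by blast
  define m where "m = max k (Suc n)"
  have gc: "g \<in> chains" using g by (simp add: cylinder_def)
  have "g (Suc n) = (X, A)" using g(1) by (simp add: cylinder_def h_def)
  then have "X \<subseteq> fst (g m)" "snd (g m) \<inter> X = A \<inter> X"
    using chains_mono[OF gc, of "Suc n" m] by (auto simp: m_def)
  moreover have "g \<in> cylinder f n" using g h by (simp add: cylinder_def)
  moreover have "cylinder g m \<subseteq> G" using k by (auto simp: cylinder_def m_def)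
  moreover have "n < m" by (simp add: m_def)
  ultimately have "refines T G b (f, n) (g, m)"
    unfolding refines_def X_def A_def by auto
  then show ?thesis by blast
qed

lemma sparse_eventually:
  assumes "sparse X"
  shows "\<exists>N::nat. \<forall>k\<ge>N. real (card (X \<inter> {..<k})) \<le> real k / 4"
proof -
  obtain N \<delta> where X: "\<delta> < 1/8" "\<And>k. real (card (X \<inter> {..<k})) \<le> N + \<delta> * real k"
    using assms unfolding sparse_def by blast
  \<comment> \<open>From \<open>8 * N\<close> on, the additive constant costs at most
    \<open>k / 8\<close>, and the slope at most another \<open>k / 8\<close>.\<close>
  obtain M :: nat where M: "8 * N \<le> real M" using real_arch_simple by blast
  have "real (card (X \<inter> {..<k})) \<le> real k / 4" if "k \<ge> M" for k
  proof -
    have "\<delta> * real k \<le> 1/8 * real k" using X(1) by (intro mult_right_mono) auto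
    moreover have "8 * N \<le> real k" using M that by linarith
    ultimately show ?thesis using X(2)[of k] by linarith
  qed
  then show ?thesis by blast
qed

text \<open>Every number below \<open>b\<close> is decided by \<open>f' n'\<close>, following
  \<open>T\<close> unless \<open>f n\<close> had decided it already; the disagreement is confined to
  the older domain.\<close>

lemma card_sym_diff_le:
  assumes "refines T G b (f, n) (f', n')" "F \<in> cylinder f n" "F \<in> cylinder f' n'" "k \<le> b"
  shows "card (sym_diff (limit_set F) T \<inter> {..<k}) \<le> card (fst (f n) \<inter> {..<k})"
proof (rule card_mono)
  have F: "F \<in> chains" "F n' = f' n'" using assms(3) by (auto simp: cylinder_def)
  have b: "{..<b} \<subseteq> fst (f' n')"
    "snd (f' n') \<inter> ({..<b} - fst (f n)) = T \<inter> ({..<b} - fst (f n))"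
    using assms(1) by (simp_all add: refines_def)
  show "sym_diff (limit_set F) T \<inter> {..<k} \<subseteq> fst (f n) \<inter> {..<k}"
  proof
    fix i assume i: "i \<in> sym_diff (limit_set F) T \<inter> {..<k}"
    then have "i < b" using assms(4) by simp
    then have "i \<in> fst (F n')" using b(1) F(2) by auto
    then have lim: "i \<in> limit_set F \<longleftrightarrow> i \<in> snd (f' n')"
      using limit_set_Int[OF F(1), of n'] F(2) by auto
    have "i \<in> snd (f' n') \<longleftrightarrow> i \<in> T" if "i \<notin> fst (f n)"
      using b(2) that \<open>i < b\<close> by blast
    then show "i \<in> fst (f n) \<inter> {..<k}" using i lim by blast
  qed
qed simp

text \<open>
  While a chain is being refined nothing is known about the density of its limit set below the
  next bound. Two chains are therefore refined alternately: each is forced to follow \<open>T\<close> while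
  the other one is refined.
\<close>

lemma fusion:
  assumes U: "openin chain_topology U" "U \<noteq> {}"
    and G: "\<forall>n::nat. dense_openin chain_topology (G n)"
  shows "\<exists>f\<in>U. \<exists>g\<in>U. (\<forall>n. f \<in> G n \<and> g \<in> G n) \<and> (\<exists>N. \<forall>k\<ge>N.
    real (card (sym_diff (limit_set f) T \<inter> {..<k})) \<le> real k / 4 \<or>
    real (card (sym_diff (limit_set g) T \<inter> {..<k})) \<le> real k / 4)"
proof -
  obtain x n0 where x: "x \<in> U" "x \<in> chains" "cylinder x n0 \<subseteq> U"
    using U unfolding openin_chain_topology by blast
  define small where "small b u \<longleftrightarrow> (\<forall>k\<ge>b. real (card (fst (fst u (snd u)) \<inter> {..<k})) \<le> real k / 4)"
    for b :: nat and u :: "(nat \<Rightarrow> nat set \<times> nat set) \<times> nat"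
  define P where "P j s \<longleftrightarrow> (case s of (u, b, v, a) \<Rightarrow> fst u \<in> chains \<and> fst v \<in> chains \<and>
      (j = 0 \<longrightarrow> u = (x, n0) \<and> v = (x, n0)))"
    for j :: nat and
      s :: "((nat \<Rightarrow> nat set \<times> nat set) \<times> nat) \<times> nat \<times> ((nat \<Rightarrow> nat set \<times> nat set) \<times> nat) \<times> nat"
  \<comment> \<open>After the first step, \<open>b\<close> and \<open>a\<close> are bounds from
    which the domains of \<open>u\<close> and \<open>v\<close> are small. Refining \<open>u\<close>
    up to \<open>a\<close> makes its limit close to \<open>T\<close> at lengths from
    \<open>b\<close> to \<open>a\<close>; refining \<open>v\<close> up to \<open>b'\<close> does the
    same for the other limit from \<open>a\<close> to \<open>b'\<close>. Together these intervals
    leave no gap.\<close>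
  define R where "R j s s' \<longleftrightarrow> (case (s, s') of ((u, b, v, a), (u', b', v', a')) \<Rightarrow>
      refines T (G j) a u u' \<and> a < b' \<and> small b' u' \<and>
      refines T (G j) b' v v' \<and> b' < a' \<and> small a' v')"
    for j :: nat and
      s s' :: "((nat \<Rightarrow> nat set \<times> nat set) \<times> nat) \<times> nat \<times> ((nat \<Rightarrow> nat set \<times> nat set) \<times> nat) \<times> nat"
  have ex: "\<exists>u' b'. refines T (G j) a u u' \<and> fst u' \<in> chains \<and> a < b' \<and> small b' u'"
    if chain: "fst u \<in> chains" for a u j
  proof -
    obtain u' where u': "refines T (G j) a u u'"
      using refines_exists[OF chain G[rule_format]] by (metis prod.collapse)
    then have c: "fst u' \<in> chains" by (auto simp: refines_def cylinder_def)
    then obtain N where "\<forall>k\<ge>N. real (card (fst (fst u' (snd u')) \<inter> {..<k})) \<le> real k / 4"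
      using sparse_eventually unfolding chains_def by blast
    then have "small (max N (Suc a)) u'" by (simp add: small_def)
    then show ?thesis using u' c by (metis less_Suc_eq max.strict_coboundedI2 lessI)
  qed
  have "\<exists>S. \<forall>j. P j (S j) \<and> R j (S j) (S (Suc j))"
  proof (rule dependent_nat_choice)
    show "\<exists>s. P 0 s"
      using x by (intro exI[of _ "((x, n0), 0, (x, n0), 0)"]) (simp add: P_def)
  next
    fix s j
    assume Ps: "P j s"
    obtain u b v a where s: "s = (u, b, v, a)" by (metis prod.collapse)
    have chain: "fst u \<in> chains" "fst v \<in> chains" using Ps by (simp_all add: P_def s)
    obtain u' b' where u': "refines T (G j) a u u'" "fst u' \<in> chains" "a < b'" "small b' u'"
      using ex[OF chain(1)] by blast
    obtain v' a' where v': "refines T (G j) b' v v'" "fst v' \<in> chains" "b' < a'" "small a' v'"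
      using ex[OF chain(2)] by blast
    show "\<exists>s'. P (Suc j) s' \<and> R j s s'"
      by (rule exI[of _ "(u', b', v', a')"]) (use u' v' in \<open>simp add: P_def R_def s\<close>)
  qed
  then obtain S where S: "\<And>j. P j (S j)" "\<And>j. R j (S j) (S (Suc j))" by blast
  define u where "u j = fst (S j)" for j
  define b where "b j = fst (snd (S j))" for j
  define v where "v j = fst (snd (snd (S j)))" for j
  define a where "a j = snd (snd (snd (S j)))" for j
  have Sj: "S j = (u j, b j, v j, a j)" for j by (simp add: u_def b_def v_def a_def)
  have c: "fst (u j) \<in> chains" "fst (v j) \<in> chains" for j
    using S(1)[of j] by (simp_all add: P_def Sj)
  have init: "u 0 = (x, n0)" "v 0 = (x, n0)"
    using S(1)[of 0] by (simp_all add: P_def Sj)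
  have r: "refines T (G j) (a j) (u j) (u (Suc j))" "a j < b (Suc j)" "small (b (Suc j)) (u (Suc j))"
    "refines T (G j) (b (Suc j)) (v j) (v (Suc j))" "b (Suc j) < a (Suc j)" "small (a (Suc j)) (v (Suc j))" for j
    using S(2)[of j] by (simp_all add: R_def Sj)
  have lim: "\<exists>F. (\<forall>j. F \<in> cylinder (fst (w j)) (snd (w j))) \<and> F \<in> U \<and> (\<forall>n. F \<in> G n)"
    if w: "\<And>j. fst (w j) \<in> chains" "\<And>j. refines T (G j) (d j) (w j) (w (Suc j))" "w 0 = (x, n0)" for w d
  proof -
    obtain F where F: "\<And>j. F \<in> cylinder (fst (w j)) (snd (w j))"
    proof (rule cylinder_limit[of "\<lambda>j. fst (w j)" "\<lambda>j. snd (w j)"])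
      show "fst (w (Suc j)) \<in> cylinder (fst (w j)) (snd (w j))" "snd (w j) < snd (w (Suc j))" for j
        using w(2)[of j] by (auto simp: refines_def split: prod.splits)
    qed (use w(1) in auto)
    have "F \<in> U" using F[of 0] x(3) w(3) by auto
    moreover have "F \<in> G j" for j
      using F[of "Suc j"] w(2)[of j] by (auto simp: refines_def split: prod.splits)
    ultimately show ?thesis using F by blast
  qed
  obtain f where f: "\<And>j. f \<in> cylinder (fst (u j)) (snd (u j))" "f \<in> U" "\<And>n. f \<in> G n"
    using lim[OF c(1) r(1) init(1)] by blast
  obtain g where g: "\<And>j. g \<in> cylinder (fst (v j)) (snd (v j))" "g \<in> U" "\<And>n. g \<in> G n"
    using lim[OF c(2) r(4) init(2)] by blast
  have le: "real (card (sym_diff (limit_set F) T \<inter> {..<k})) \<le> real k / 4"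
    if "refines T H d w w'" "F \<in> cylinder (fst w) (snd w)" "F \<in> cylinder (fst w') (snd w')"
      "small e w" "e \<le> k" "k \<le> d" for F H w w' k d e
  proof -
    have "real (card (sym_diff (limit_set F) T \<inter> {..<k})) \<le> real (card (fst (fst w (snd w)) \<inter> {..<k}))"
      using card_sym_diff_le[of T H d "fst w" "snd w" "fst w'" "snd w'" F k] that by simp
    also have "\<dots> \<le> real k / 4"
      using that(4,5) by (simp add: small_def)
    finally show ?thesis .
  qed
  have le_b: "i \<le> b (Suc i)" for i
  proof (induction i)
    case (Suc i)
    then show ?case using r(5)[of i] r(2)[of "Suc i"] by linarith
  qed simp
  have small_diff: "real (card (sym_diff (limit_set f) T \<inter> {..<k})) \<le> real k / 4 \<or>
        real (card (sym_diff (limit_set g) T \<inter> {..<k})) \<le> real k / 4" if "k \<ge> b 1" for k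
  proof -
    \<comment> \<open>This gives \<open>b (Suc j) \<le> k < b (Suc (Suc j))\<close>; within this
      block \<open>f\<close> is good up to \<open>a (Suc j)\<close> and \<open>g\<close> afterwards.
      The shift skips the initial state, whose bounds guarantee no smallness.\<close>
    define j where "j = (LEAST i. k < b (Suc (Suc i)))"
    have "k < b (Suc (Suc k))"
      using le_b[of "Suc k"] by simp
    then have j: "k < b (Suc (Suc j))" unfolding j_def by (rule LeastI)
    have j': "b (Suc j) \<le> k"
    proof (cases j)
      case (Suc i)
      then have "\<not> k < b (Suc (Suc i))"
        using not_less_Least[of i "\<lambda>i. k < b (Suc (Suc i))"] unfolding j_def[symmetric] by simp
      then show ?thesis using Suc by simp
    qed (use that in simp)
    show ?thesis
    proof (cases "k \<le> a (Suc j)")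
      case True
      then show ?thesis
        by (intro disjI1 le[OF r(1)[of "Suc j"] f(1) f(1) r(3)[of j] j'])
    next
      case False
      then show ?thesis
        by (intro disjI2 le[OF r(4)[of "Suc j"] g(1) g(1) r(6)[of j]]) (use j in simp_all)
    qed
  qed
  show ?thesis
    by (intro bexI[OF _ f(2)] bexI[OF _ g(2)] conjI allI exI[of _ "b 1"] impI)
      (rule f(3) g(3) small_diff, assumption?)+
qed

section \<open>The density functional\<close>

text \<open>Of the two chains produced by the fusion, this selects one that is good along
  \<open>p\<close>.\<close>

lemma ultrafilter_disj:
  assumes "ultrafilter F" "eventually (\<lambda>x. P x \<or> Q x) F"
  shows "eventually P F \<or> eventually Q F"
proof (rule ccontr)
  assume "\<not> ?thesis"
  then have "eventually (\<lambda>x. \<not> P x) F" "eventually (\<lambda>x. \<not> Q x) F"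
    using assms(1) unfolding ultrafilter_def by blast+
  with assms(2) have "eventually (\<lambda>x. False) F"
    by eventually_elim blast
  then show False using assms(1) by (simp add: ultrafilter_def)
qed

text \<open>An ultrafilter with a singleton as a member is principal, so a nonprincipal one omits
  every finite set.\<close>

lemma eventually_ge_nonprincipal:
  assumes "p \<notin> range point"
  shows "\<forall>\<^sub>F n in filter_of p. N \<le> n"
proof -
  have "\<forall>\<^sub>F n in filter_of p. n \<noteq> m" for m
  proof (rule ccontr)
    assume "\<not> ?thesis"
    then have m: "\<forall>\<^sub>F n in filter_of p. n = m"
      using ultrafilter_filter_of[of p] unfolding ultrafilter_def by fastforce
    have "eventually P (filter_of p) \<longleftrightarrow> P m" for P
    proof
      assume "eventually P (filter_of p)"
      with m have "\<forall>\<^sub>F n in filter_of p. P m" by eventually_elim simp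
      then show "P m" using ultrafilter_filter_of[of p] by (simp add: ultrafilter_def)
    next
      assume "P m"
      with m show "eventually P (filter_of p)" by (auto elim: eventually_mono)
    qed
    then have "filter_of p = filter_of (point m)"
      by (simp add: filter_eq_iff filter_of_point eventually_principal)
    then show False using assms by (simp add: filter_of_inject)
  qed
  then have "\<forall>\<^sub>F n in filter_of p. \<forall>m\<in>{..<N}. n \<noteq> m"
    by (intro eventually_ball_finite) auto
  then show ?thesis by (rule eventually_mono) (use not_less in auto)
qed

lemma ultrafilter_density_le:
  assumes "\<forall>\<^sub>F k in filter_of p. real (card (A \<inter> {..<k})) \<le> c * real k" "0 \<le> c"
  shows "ultrafilter_density p A \<le> c"
proof (rule tendsto_upperbound[OF tendsto_ultrafilter_density])
  show "\<forall>\<^sub>F k in filter_of p. real (card (A \<inter> {0..<k})) / real k \<le> c"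
    using assms(1)
  proof eventually_elim
    case (elim k)
    \<comment> \<open>At \<open>k = 0\<close> the quotient is 0 by convention, and the bound holds
      there because \<open>0 \<le> c\<close>.\<close>
    then show ?case using assms(2) by (cases "k = 0") (simp_all add: lessThan_atLeast0 pos_divide_le_eq)
  qed
  show "filter_of p \<noteq> bot" using ultrafilter_filter_of by (simp add: ultrafilter_def)
qed

text \<open>The two quotients count \<open>A\<close> and its complement. They add up to 1 except at
  \<open>n = 0\<close>, where both are 0; nonprincipality excludes that index.\<close>

lemma ultrafilter_density_UNIV_le:
  assumes "p \<notin> range point"
  shows "1 \<le> ultrafilter_density p A + ultrafilter_density p (sym_diff A UNIV)"
proof (rule tendsto_lowerbound)
  show "((\<lambda>n. real (card (A \<inter> {0..<n})) / real n + real (card (sym_diff A UNIV \<inter> {0..<n})) / real n)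
      \<longlongrightarrow> ultrafilter_density p A + ultrafilter_density p (sym_diff A UNIV)) (filter_of p)"
    by (intro tendsto_add tendsto_ultrafilter_density)
  show "\<forall>\<^sub>F n in filter_of p. 1 \<le> real (card (A \<inter> {0..<n})) / real n
      + real (card (sym_diff A UNIV \<inter> {0..<n})) / real n"
    using eventually_ge_nonprincipal[OF assms, of 1]
  proof eventually_elim
    case (elim n)
    have "card (A \<inter> {0..<n}) + card (sym_diff A UNIV \<inter> {0..<n})
        = card ((A \<inter> {0..<n}) \<union> (sym_diff A UNIV \<inter> {0..<n}))"
      by (rule card_Un_disjoint[symmetric]) auto
    also have "(A \<inter> {0..<n}) \<union> (sym_diff A UNIV \<inter> {0..<n}) = {0..<n}" by blast
    finally have "real (card (A \<inter> {0..<n})) + real (card (sym_diff A UNIV \<inter> {0..<n})) = real n"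
      by (metis card_atLeastLessThan diff_zero of_nat_add)
    then show ?case using elim by (simp add: add_divide_distrib[symmetric])
  qed
  show "filter_of p \<noteq> bot" using ultrafilter_filter_of by (simp add: ultrafilter_def)
qed

lemma density_fusion:
  assumes "p \<notin> range point" "openin chain_topology U" "U \<noteq> {}"
    "\<forall>n::nat. dense_openin chain_topology (G n)"
  shows "\<exists>f\<in>U. (\<forall>n. f \<in> G n) \<and> ultrafilter_density p (sym_diff (limit_set f) T) \<le> 1/4"
proof -
  obtain f g N where f: "f \<in> U" "\<forall>n. f \<in> G n" and g: "g \<in> U" "\<forall>n. g \<in> G n"
    and N: "\<And>k. k \<ge> N \<Longrightarrow>
      real (card (sym_diff (limit_set f) T \<inter> {..<k})) \<le> real k / 4 \<or>
      real (card (sym_diff (limit_set g) T \<inter> {..<k})) \<le> real k / 4"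
    using fusion[OF assms(2-4), of T] by auto
  have "\<forall>\<^sub>F k in filter_of p.
      real (card (sym_diff (limit_set f) T \<inter> {..<k})) \<le> 1/4 * real k \<or>
      real (card (sym_diff (limit_set g) T \<inter> {..<k})) \<le> 1/4 * real k"
    using eventually_ge_nonprincipal[OF assms(1), of N] by eventually_elim (use N in force)
  then have "(\<forall>\<^sub>F k in filter_of p. real (card (sym_diff (limit_set f) T \<inter> {..<k})) \<le> 1/4 * real k) \<or>
      (\<forall>\<^sub>F k in filter_of p. real (card (sym_diff (limit_set g) T \<inter> {..<k})) \<le> 1/4 * real k)"
    by (rule ultrafilter_disj[OF ultrafilter_filter_of])
  then show ?thesis
  proof
    assume "\<forall>\<^sub>F k in filter_of p. real (card (sym_diff (limit_set f) T \<inter> {..<k})) \<le> 1/4 * real k"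
    then show ?thesis
      using f by (intro bexI[of _ f] conjI ultrafilter_density_le) simp_all
  next
    assume "\<forall>\<^sub>F k in filter_of p. real (card (sym_diff (limit_set g) T \<inter> {..<k})) \<le> 1/4 * real k"
    then show ?thesis
      using g by (intro bexI[of _ g] conjI ultrafilter_density_le) simp_all
  qed
qed

lemma chains_nonempty: "chains \<noteq> {}"
proof -
  have "sparse {}" unfolding sparse_def by (intro exI[of _ 0]) simp
  then have "(\<lambda>_. ({}, {})) \<in> chains" by (simp add: chains_def)
  then show ?thesis by blast
qed

text \<open>Phrased for any \<open>\<phi>\<close> with the right values on indicators, so that it
  covers both the integral and the limit of averages.\<close>

lemma not_borel_measurable_pointwise:
  fixes \<phi> :: "(beta_omega \<Rightarrow>\<^sub>C real) \<Rightarrow> real"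
  assumes p: "p \<notin> range point"
    and \<phi>: "\<And>A. \<phi> (clopen_indicator A) = ultrafilter_density p A"
  shows "\<phi> \<notin> borel_measurable (borel_of pointwise_topology)"
proof
  assume "\<phi> \<in> borel_measurable (borel_of pointwise_topology)"
  then have "{f \<in> space (borel_of pointwise_topology). \<phi> f < 1/2} \<in> sets (borel_of pointwise_topology)"
    unfolding borel_measurable_iff_less by blast
  then have "{f. \<phi> f < 1/2} \<in> sets (borel_of pointwise_topology)"
    by (simp add: borel_of_def space_measure_of_conv topspace_pointwise_topology)
  from baire_property_pointwise_borel[OF this]
  obtain U G where U: "openin chain_topology U" and G: "\<forall>n::nat. dense_openin chain_topology (G n)"
    and eq: "\<And>f. f \<in> chains \<Longrightarrow> \<forall>n. f \<in> G n \<Longrightarrow>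
      ultrafilter_density p (limit_set f) < 1/2 \<longleftrightarrow> f \<in> U"
    unfolding baire_property_def topspace_chain_topology mem_Collect_eq \<phi> by blast
  \<comment> \<open>If \<open>U\<close> is empty, a chain in all \<open>G n\<close> with limit
    density at most 1/4 is a contradiction; otherwise one in \<open>U\<close> with limit density at
    least 3/4 is.\<close>
  show False
  proof (cases "U = {}")
    case True
    have "openin chain_topology chains"
      by (metis openin_topspace topspace_chain_topology)
    then obtain f where f: "f \<in> chains" "\<forall>n. f \<in> G n"
      "ultrafilter_density p (sym_diff (limit_set f) {}) \<le> 1/4"
      using density_fusion[OF p _ chains_nonempty G] by blast
    then show False using eq[OF f(1,2)] True by simp
  next
    case False
    then obtain f where f: "f \<in> U" "\<forall>n. f \<in> G n"
      "ultrafilter_density p (sym_diff (limit_set f) UNIV) \<le> 1/4"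
      using density_fusion[OF p U _ G] by blast
    have "f \<in> chains" using f(1) U unfolding openin_chain_topology by blast
    then show False
      using eq[OF _ f(2)] f(1,3) ultrafilter_density_UNIV_le[OF p, of "limit_set f"] by simp
  qed
qed

section \<open>Averages and the weak topology\<close>

definition average :: "nat \<Rightarrow> (beta_omega \<Rightarrow>\<^sub>C real) \<Rightarrow> real" where
  "average n f = (\<Sum>k<n. apply_bcontfun f (point k)) / real n"

lemma average_bounds: "average n f \<in> {- norm f..norm f}"
proof -
  have "\<bar>\<Sum>k<n. apply_bcontfun f (point k)\<bar> \<le> (\<Sum>k<n. norm f)"
    by (rule order_trans[OF sum_abs]) (intro sum_mono, metis norm_bounded real_norm_def)
  then have "\<bar>average n f\<bar> \<le> norm f"
    by (cases "n = 0") (simp_all add: average_def pos_divide_le_eq mult.commute)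
  then show ?thesis by (simp add: abs_le_iff)
qed

text \<open>Averages are linear and bounded by the norm, so their limits along an ultrafilter exist
  and inherit both properties.\<close>

lemma bounded_linear_Lim_average: "bounded_linear (\<lambda>f. Lim (filter_of p) (\<lambda>n. average n f))"
proof -
  have bot: "filter_of p \<noteq> bot" using ultrafilter_filter_of by (simp add: ultrafilter_def)
  have lim: "((\<lambda>n. average n f) \<longlongrightarrow> Lim (filter_of p) (\<lambda>n. average n f)) (filter_of p)" for f
    by (rule ultrafilter_lim[OF ultrafilter_filter_of average_bounds])
  show ?thesis
  proof (rule bounded_linear_intro[where K = 1])
    fix f g :: "beta_omega \<Rightarrow>\<^sub>C real"
    have "(\<lambda>n. average n (f + g)) = (\<lambda>n. average n f + average n g)"
      by (simp add: average_def sum.distrib add_divide_distrib)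
    then show "Lim (filter_of p) (\<lambda>n. average n (f + g))
        = Lim (filter_of p) (\<lambda>n. average n f) + Lim (filter_of p) (\<lambda>n. average n g)"
      using tendsto_Lim[OF bot tendsto_add[OF lim lim]] by simp
  next
    fix c :: real and f :: "beta_omega \<Rightarrow>\<^sub>C real"
    have "(\<lambda>n. average n (c *\<^sub>R f)) = (\<lambda>n. c * average n f)"
      by (simp add: average_def sum_distrib_left)
    then show "Lim (filter_of p) (\<lambda>n. average n (c *\<^sub>R f)) = c *\<^sub>R Lim (filter_of p) (\<lambda>n. average n f)"
      using tendsto_Lim[OF bot tendsto_mult_left[OF lim]] by simp
  next
    fix f :: "beta_omega \<Rightarrow>\<^sub>C real"
    have "Lim (filter_of p) (\<lambda>n. average n f) \<le> norm f"
      by (rule tendsto_upperbound[OF lim _ bot]) (use average_bounds in simp)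
    moreover have "- norm f \<le> Lim (filter_of p) (\<lambda>n. average n f)"
      by (rule tendsto_lowerbound[OF lim _ bot]) (use average_bounds in simp)
    ultimately show "norm (Lim (filter_of p) (\<lambda>n. average n f)) \<le> norm f * 1"
      by (simp add: abs_le_iff)
  qed
qed

lemma average_clopen_indicator:
  "average n (clopen_indicator A) = real (card (A \<inter> {0..<n})) / real n"
proof -
  have "point k \<in> basic_clopen A \<longleftrightarrow> k \<in> A" for k
    by (simp add: basic_clopen_def filter_of_point eventually_principal)
  then have "(\<Sum>k<n. apply_bcontfun (clopen_indicator A) (point k)) = (\<Sum>k<n. indicator A k)"
    by (simp add: apply_clopen_indicator indicator_def)
  also have "\<dots> = real (card (A \<inter> {0..<n}))"
    by (simp add: indicator_def sum.If_cases Int_commute lessThan_atLeast0)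
  finally show ?thesis by (simp add: average_def)
qed

lemma borel_measurable_weak:
  fixes \<phi> :: "'a :: real_normed_vector \<Rightarrow> real"
  assumes "bounded_linear \<phi>"
  shows "\<phi> \<in> borel_measurable (borel_of weak_topology)"
proof (rule borel_measurableI)
  fix V :: "real set" assume "open V"
  then have "openin weak_topology (\<phi> -` V)"
    using assms unfolding weak_topology_def initial_topology_def
    by (intro topology_generated_by_Basis) blast
  then show "\<phi> -` V \<inter> space (borel_of weak_topology) \<in> sets (borel_of weak_topology)"
    by (simp add: sets_borel_of borel_of_def space_measure_of_conv topspace_weak_topology sigma_sets.Basic)
qed

theorem theorem3p5:
  fixes p :: beta_omega
  assumes "p \<notin> range point"
  shows "(\<forall>M :: beta_omega measure.
            radon_measure M \<and> (\<forall>A. measure M (closure (point ` A)) = ultrafilter_density p A) \<longrightarrow>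
            (\<lambda>f :: beta_omega \<Rightarrow>\<^sub>C real. \<integral>x. apply_bcontfun f x \<partial>M)
              \<notin> borel_measurable (borel_of pointwise_topology))
         \<and> sets (borel_of (pointwise_topology :: (beta_omega \<Rightarrow>\<^sub>C real) topology))
             \<noteq> sets (borel_of weak_topology)"
proof (intro conjI allI impI)
  fix M :: "beta_omega measure"
  assume M: "radon_measure M \<and> (\<forall>A. measure M (closure (point ` A)) = ultrafilter_density p A)"
  then have "sets M = sets borel" by (simp add: radon_measure_def)
  then have sp: "space M = UNIV" by (metis sets_eq_imp_space_eq space_borel)
  show "(\<lambda>f. \<integral>x. apply_bcontfun f x \<partial>M) \<notin> borel_measurable (borel_of pointwise_topology)"
  proof (rule not_borel_measurable_pointwise[OF assms])
    fix A
    have "(\<integral>x. apply_bcontfun (clopen_indicator A) x \<partial>M) = measure M (basic_clopen A)"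
      by (simp add: apply_clopen_indicator sp)
    then show "(\<integral>x. apply_bcontfun (clopen_indicator A) x \<partial>M) = ultrafilter_density p A"
      using M by (simp add: closure_point_image)
  qed
next
  \<comment> \<open>The first conjunct presupposes a measure \<open>M\<close>; here the limit of
    averages separates the two Borel structures directly.\<close>
  define \<phi> where "\<phi> f = Lim (filter_of p) (\<lambda>n. average n f)" for f
  have "\<phi> (clopen_indicator A) = ultrafilter_density p A" for A
    by (simp add: \<phi>_def average_clopen_indicator ultrafilter_density_def)
  then have "\<phi> \<notin> borel_measurable (borel_of pointwise_topology)"
    by (rule not_borel_measurable_pointwise[OF assms])
  moreover have "\<phi> \<in> borel_measurable (borel_of weak_topology)"
    unfolding \<phi>_def by (intro borel_measurable_weak bounded_linear_Lim_average)
  ultimately show "sets (borel_of (pointwise_topology :: (beta_omega \<Rightarrow>\<^sub>C real) topology))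
      \<noteq> sets (borel_of weak_topology)"
    using measurable_cong_sets by blast
qed

end
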